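(* Let $r,s,t$ be positive integers with $r\ge 2$ and $t\ge\max\{2,s\}$, and let $H$ be any connected bipartite graph of order at least $3$. Then there is a constant $C = C(H,r,s,t)$ such that, if $n$ is large enough, every $2$-edge-coloring $E(K_n)=E(R)\cup E(B)$ with $\min\{e(R),e(B)\}\ge C\,\mathrm{ex}(n,H)$ that contains no monochromatic weakly induced $rH$ contains an induced monochromatic member of $\mathcal{F}_{s,t} = \{K_{s,t},S_{t,t}\}$.
   Context: $\mathrm{ex}(n,H)$ is the Turán number: the maximum number of edges in an $n$-vertex graph containing no copy of $H$. A $2$-edge-coloring of $K_n$ is a partition $E(K_n)=E(R)\cup E(B)$ into red and blue edges; $e(R),e(B)$ are their sizes. The coloring contains an induced monochromatic copy of a graph $F$ if there is $U\subseteq V(K_n)$ with $|U|=|V(F)|$ such that the red edges inside $U$, or the blue edges inside $U$, form a graph isomorphic to $F$. $rH$ is the disjoint union of $r$ copies of $H$. A graph $F$ is weakly induced in a graph $G$ if $F$ is a subgraph of $G$ and no edge of $G$ joins two distinct components of $F$; a monochromatic weakly induced $rH$ is a copy of $rH$ weakly induced in the red graph $R$ or in the blue graph $B$. $K_{s,t}$ is the complete bipartite graph with parts of sizes $s,t$; $S_{t,t}$ is the complete split graph consisting of a clique on $t$ vertices, an independent set on $t$ vertices, and all edges between them. *)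

theory Defs
  imports Complex_Main "HOL-Library.Ramsey"
begin

text \<open>Edges are two-element sets of vertices; \<open>[V]\<^bsup>2\<^esup>\<close> is the set of all two-element
  subsets of \<open>V\<close>.\<close>

datatype 'a ugraph = Graph (verts: "'a set") (edges: "'a set set")

definition simple_graph :: "'a ugraph \<Rightarrow> bool" where
  "simple_graph G \<longleftrightarrow> finite (verts G) \<and> edges G \<subseteq> [verts G]\<^bsup>2\<^esup>"

definition subgraph :: "'a ugraph \<Rightarrow> 'a ugraph \<Rightarrow> bool" where
  "subgraph F G \<longleftrightarrow> simple_graph F \<and> verts F \<subseteq> verts G \<and> edges F \<subseteq> edges G"

definition induced :: "'a ugraph \<Rightarrow> 'a set \<Rightarrow> 'a ugraph" where
  "induced G U = Graph U {e \<in> edges G. e \<subseteq> U}"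

definition graph_iso :: "'a ugraph \<Rightarrow> 'b ugraph \<Rightarrow> bool" where
  "graph_iso G H \<longleftrightarrow>
    (\<exists>f. bij_betw f (verts G) (verts H) \<and> edges H = (\<lambda>e. f ` e) ` edges G)"

definition reachable :: "'a ugraph \<Rightarrow> ('a \<times> 'a) set" where
  "reachable G = {(u, v) \<in> verts G \<times> verts G. (u, v) \<in> {(x, y). {x, y} \<in> edges G}\<^sup>*}"

definition connected_graph :: "'a ugraph \<Rightarrow> bool" where
  "connected_graph G \<longleftrightarrow> verts G \<noteq> {} \<and> (\<forall>u\<in>verts G. \<forall>v\<in>verts G. (u, v) \<in> reachable G)"

text \<open>A component is represented by its vertex set.\<close>

definition components :: "'a ugraph \<Rightarrow> 'a set set" where
  "components G = verts G // reachable G"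

definition bipartite :: "'a ugraph \<Rightarrow> bool" where
  "bipartite G \<longleftrightarrow>
    (\<exists>X Y. X \<union> Y = verts G \<and> X \<inter> Y = {} \<and> (\<forall>e\<in>edges G. \<exists>x\<in>X. \<exists>y\<in>Y. e = {x, y}))"

text \<open>\<open>Max\<close> is taken over a finite set, which is nonempty as soon as \<open>H\<close> has an edge.\<close>

definition ex :: "nat \<Rightarrow> 'a ugraph \<Rightarrow> nat" where
  "ex n H = Max {card (edges G) | G :: nat ugraph.
     simple_graph G \<and> card (verts G) = n \<and> \<not> (\<exists>F. subgraph F G \<and> graph_iso F H)}"

definition complete_graph :: "nat \<Rightarrow> nat ugraph" where
  "complete_graph n = Graph {..<n} ([{..<n}]\<^bsup>2\<^esup>)"

definition complete_bipartite :: "nat \<Rightarrow> nat \<Rightarrow> (nat + nat) ugraph" where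
  "complete_bipartite s t =
    Graph ({..<s} <+> {..<t}) {{Inl i, Inr j} | i j. i < s \<and> j < t}"

text \<open>The left summand carries the clique, the right one the independent set.\<close>

definition complete_split :: "nat \<Rightarrow> nat \<Rightarrow> (nat + nat) ugraph" where
  "complete_split s t =
    Graph ({..<s} <+> {..<t})
      ({{Inl i, Inl j} | i j. i < s \<and> j < s \<and> i \<noteq> j} \<union> {{Inl i, Inr j} | i j. i < s \<and> j < t})"

definition family :: "nat \<Rightarrow> nat \<Rightarrow> (nat + nat) ugraph set" where
  "family s t = {complete_bipartite s t, complete_split t t}"

definition disjoint_copies :: "nat \<Rightarrow> 'a ugraph \<Rightarrow> (nat \<times> 'a) ugraph" where
  "disjoint_copies r H =
    Graph ({..<r} \<times> verts H) {Pair i ` e | i e. i < r \<and> e \<in> edges H}"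

definition weakly_induced :: "'a ugraph \<Rightarrow> 'a ugraph \<Rightarrow> bool" where
  "weakly_induced F G \<longleftrightarrow> subgraph F G \<and>
    \<not> (\<exists>X\<in>components F. \<exists>Y\<in>components F. X \<noteq> Y \<and> (\<exists>x\<in>X. \<exists>y\<in>Y. {x, y} \<in> edges G))"

text \<open>The colour classes are spanning subgraphs of \<open>K\<^sub>n\<close>.\<close>

definition two_edge_coloring :: "nat \<Rightarrow> nat ugraph \<Rightarrow> nat ugraph \<Rightarrow> bool" where
  "two_edge_coloring n R B \<longleftrightarrow>
    verts R = verts (complete_graph n) \<and> verts B = verts (complete_graph n) \<and>
    edges R \<union> edges B = edges (complete_graph n) \<and> edges R \<inter> edges B = {}"

definition has_mono_weakly_induced_copies ::
    "nat ugraph \<Rightarrow> nat ugraph \<Rightarrow> nat \<Rightarrow> 'a ugraph \<Rightarrow> bool" where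
  "has_mono_weakly_induced_copies R B r H \<longleftrightarrow>
    (\<exists>F. graph_iso F (disjoint_copies r H) \<and> (weakly_induced F R \<or> weakly_induced F B))"

definition has_induced_mono_copy :: "nat \<Rightarrow> nat ugraph \<Rightarrow> nat ugraph \<Rightarrow> 'a ugraph \<Rightarrow> bool" where
  "has_induced_mono_copy n R B F \<longleftrightarrow>
    (\<exists>U. U \<subseteq> verts (complete_graph n) \<and> card U = card (verts F) \<and>
      (graph_iso (induced R U) F \<or> graph_iso (induced B U) F))"

end

theory Submission
  imports Defs
begin

text \<open>Since a perfect matching contains no \<open>H\<close>, \<open>ex n H\<close> is at least linear in \<open>n\<close>. So deleting
  boundedly many vertices destroys only \<open>O(ex n H)\<close> edges, and each colour contains many
  vertex-disjoint copies of \<open>H\<close>. By Ramsey's theorem we may assume that the colour between the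
  \<open>a\<close>-th vertex of an earlier copy and the \<open>b\<close>-th vertex of a later one depends only on \<open>(a, b)\<close>.
  If in the red copies all these colours are blue, then \<open>r\<close> of the copies are weakly induced in red.
  If \<open>(a, a)\<close> is red for some \<open>a\<close>, there is a large red clique. Otherwise some \<open>(a, b)\<close> is red while
  \<open>(a, a)\<close> and \<open>(b, b)\<close> are blue, which gives an induced red \<open>K\<^sub>s\<^sub>,\<^sub>t\<close>. We may therefore assume
  that there are a large red and a large blue clique; Ramsey's theorem applied to the edges between
  them gives an induced monochromatic \<open>S\<^sub>t\<^sub>,\<^sub>t\<close>.\<close>

section \<open>Homogeneous subsequences\<close>

text \<open>Only \<open>i < j\<close> is read, so \<open>c\<close> may be asymmetric: it will
  compare one vertex of an earlier copy with a different vertex of a later copy.\<close>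

definition homogeneous :: "nat \<Rightarrow> (nat \<Rightarrow> nat \<Rightarrow> bool) \<Rightarrow> bool" where
  "homogeneous m c \<longleftrightarrow> (\<exists>q. \<forall>i j. i < j \<and> j < m \<longrightarrow> c i j = q)"

lemma homogeneousI:
  assumes "\<And>i j. i < j \<Longrightarrow> j < m \<Longrightarrow> c i j = q"
  shows "homogeneous m c"
  unfolding homogeneous_def
proof (intro exI[of _ q] allI impI)
  show "c i j = q" if "i < j \<and> j < m" for i j
    using assms[of i j] that by simp
qed

text \<open>Recording \<open>c\<close> at increasing pairs gives a graph, to which Ramsey's theorem
  applies. Enumerating the clique or independent set increasingly keeps each pair in the order in
  which its colour was read.\<close>

lemma ramsey_increasing:
  "\<exists>M::nat. \<forall>c. \<exists>e. strict_mono_on {..<m} e \<and> e ` {..<m} \<subseteq> {..<M} \<and>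
    homogeneous m (\<lambda>i j. c (e i) (e j))"
proof -
  obtain M :: nat where M: "\<And>(V::nat set) E. finite V \<Longrightarrow> M \<le> card V \<Longrightarrow>
      \<exists>Z\<subseteq>V. card Z = m \<and> clique Z E \<or> card Z = m \<and> indep Z E"
    using ramsey2[of m m] by blast
  have "\<exists>e. strict_mono_on {..<m} e \<and> e ` {..<m} \<subseteq> {..<M} \<and>
    homogeneous m (\<lambda>i j. c (e i) (e j))" for c :: "nat \<Rightarrow> nat \<Rightarrow> bool"
  proof -
    define E where "E = {{i, j} | i j. i < j \<and> c i j}"
    have E: "{i, j} \<in> E \<longleftrightarrow> c i j" if "i < j" for i j
      using that by (auto simp: E_def doubleton_eq_iff)
    obtain Z where Z: "Z \<subseteq> {..<M}" "card Z = m" "clique Z E \<or> indep Z E"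
      using M[of "{..<M}" E] by auto
    then have "finite Z"
      using finite_subset by blast
    then obtain e where e: "bij_betw e {..<m} Z" "strict_mono_on {..<m} e"
      using Z(2) by (metis ex_bij_betw_strict_mono_card)
    have "homogeneous m (\<lambda>i j. c (e i) (e j))"
    proof (rule homogeneousI)
      fix i j assume "i < j" "j < m"
      then have "e i < e j" "e i \<in> Z" "e j \<in> Z"
        using e by (auto simp: strict_mono_on_def bij_betw_def)
      \<comment> \<open>A pair of distinct members of \<open>Z\<close> exists here, so
        \<open>clique Z E\<close> and \<open>indep Z E\<close> exclude each other and the truth
        value of the former is the common colour.\<close>
      then show "c (e i) (e j) = clique Z E"
        using Z(3) E[of "e i" "e j"] unfolding clique_def indep_def by (metis less_irrefl)
    qed
    then show ?thesis
      using e Z(1) by (auto simp: bij_betw_def)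
  qed
  then show ?thesis by blast
qed

text \<open>Ramsey's theorem is iterated over the colourings: homogeneity passes to increasing
  subsequences, so a sequence that is already good for \<open>P\<close> can be thinned out once more
  for \<open>p\<close>.\<close>

lemma ramsey_increasing_simultaneous:
  assumes "finite P"
  shows "\<exists>M::nat. \<forall>c::'p \<Rightarrow> nat \<Rightarrow> nat \<Rightarrow> bool. \<exists>e. strict_mono_on {..<m} e \<and>
    e ` {..<m} \<subseteq> {..<M} \<and> (\<forall>p\<in>P. homogeneous m (\<lambda>i j. c p (e i) (e j)))"
  using assms
proof (induction P arbitrary: m rule: finite_induct)
  case empty
  have "strict_mono_on {..<m} (\<lambda>i. i)"
    by (auto simp: strict_mono_on_def)
  then show ?case by (intro exI[of _ m] allI exI[of _ "\<lambda>i. i"]) simp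
next
  case (insert p P)
  \<comment> \<open>\<open>N\<close> is the length that the colourings in \<open>P\<close> must
    leave over, so that the thinning for \<open>p\<close> still yields \<open>m\<close>
    terms.\<close>
  obtain N where N: "\<forall>c. \<exists>e. strict_mono_on {..<m} e \<and> e ` {..<m} \<subseteq> {..<N::nat} \<and>
      homogeneous m (\<lambda>i j. c (e i) (e j))"
    using ramsey_increasing[of m] by (rule exE)
  obtain M where M: "\<forall>c::'p \<Rightarrow> nat \<Rightarrow> nat \<Rightarrow> bool. \<exists>e. strict_mono_on {..<N} e \<and>
      e ` {..<N} \<subseteq> {..<M} \<and> (\<forall>p\<in>P. homogeneous N (\<lambda>i j. c p (e i) (e j)))"
    using insert.IH[of N] by (rule exE)
  have "\<exists>e. strict_mono_on {..<m} e \<and> e ` {..<m} \<subseteq> {..<M} \<and>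
      (\<forall>p\<in>insert p P. homogeneous m (\<lambda>i j. c p (e i) (e j)))"
    for c :: "'p \<Rightarrow> nat \<Rightarrow> nat \<Rightarrow> bool"
  proof -
    obtain e where e: "strict_mono_on {..<N} e" "e ` {..<N} \<subseteq> {..<M}"
      "\<forall>p\<in>P. homogeneous N (\<lambda>i j. c p (e i) (e j))"
      using M[THEN spec, of c] by (elim exE conjE) (rule that)
    obtain d where d: "strict_mono_on {..<m} d" "d ` {..<m} \<subseteq> {..<N}"
      "homogeneous m (\<lambda>i j. c p (e (d i)) (e (d j)))"
      using N[THEN spec, of "\<lambda>i j. c p (e i) (e j)"] by (elim exE conjE) (rule that)
    have dlt: "d i < d j" "d j < N" if "i < j" "j < m" for i j
      using d(1,2) that by (auto simp: strict_mono_on_def)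
    have 1: "strict_mono_on {..<m} (e \<circ> d)"
    proof (rule strict_mono_onI)
      fix i j assume "i \<in> {..<m}" "j \<in> {..<m}" "i < j"
      then show "(e \<circ> d) i < (e \<circ> d) j"
        using dlt[of i j] e(1) by (auto simp: strict_mono_on_def)
    qed
    have 2: "(e \<circ> d) ` {..<m} \<subseteq> {..<M}"
      using e(2) d(2) by fastforce
    have "homogeneous m (\<lambda>i j. c p' ((e \<circ> d) i) ((e \<circ> d) j))" if p': "p' \<in> insert p P" for p'
    proof (cases "p' = p")
      case True
      then show ?thesis using d(3) by simp
    next
      case False
      then have "homogeneous N (\<lambda>i j. c p' (e i) (e j))"
        using e(3) p' by simp
      then obtain q where q: "\<forall>i j. i < j \<and> j < N \<longrightarrow> c p' (e i) (e j) = q"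
        unfolding homogeneous_def by (rule exE)
      show ?thesis
      proof (rule homogeneousI)
        show "c p' ((e \<circ> d) i) ((e \<circ> d) j) = q" if "i < j" "j < m" for i j
          using q[rule_format, of "d i" "d j"] dlt[OF that] by simp
      qed
    qed
    then show ?thesis
      by (intro exI[of _ "e \<circ> d"] conjI ballI 1 2)
  qed
  then show ?case by (intro exI[of _ M] allI)
qed

section \<open>Embeddings and the Turan number\<close>

text \<open>A not necessarily induced copy of \<open>H\<close> in \<open>G\<close>, given by a map
  out of \<open>H\<close>; such maps are easier to combine than subgraphs with isomorphisms onto
  \<open>H\<close>.\<close>

definition embedding :: "'a ugraph \<Rightarrow> 'b ugraph \<Rightarrow> ('a \<Rightarrow> 'b) \<Rightarrow> bool" where
  "embedding H G f \<longleftrightarrow> inj_on f (verts H) \<and> f ` verts H \<subseteq> verts G \<and>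
    (\<forall>e\<in>edges H. f ` e \<in> edges G)"

lemma edge_subset_verts: "simple_graph G \<Longrightarrow> e \<in> edges G \<Longrightarrow> e \<subseteq> verts G"
  by (auto simp: simple_graph_def nsets_def)

lemma simple_graph_finite_edges: "simple_graph G \<Longrightarrow> finite (edges G)"
  by (metis simple_graph_def finite_imp_finite_nsets finite_subset)

text \<open>The isomorphism points from \<open>F\<close> to \<open>H\<close>, so its inverse is the
  embedding. It recovers every edge because edges of \<open>F\<close> lie in \<open>verts F\<close>,
  where the isomorphism is injective.\<close>

lemma graph_iso_subgraph_embedding:
  assumes "subgraph F G" "graph_iso F H"
  shows "\<exists>f. embedding H G f"
proof -
  obtain h where h: "bij_betw h (verts F) (verts H)" "edges H = (\<lambda>e. h ` e) ` edges F"
    using assms(2) by (auto simp: graph_iso_def)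
  let ?f = "inv_into (verts F) h"
  have "bij_betw ?f (verts H) (verts F)"
    by (simp add: bij_betw_inv_into h(1))
  moreover have "?f ` e \<in> edges G" if e: "e \<in> edges H" for e
  proof -
    obtain d where d: "d \<in> edges F" "e = h ` d"
      using h(2) e by auto
    then have "?f ` e = d"
      using h(1) assms(1) edge_subset_verts[of F d]
      by (auto simp: subgraph_def bij_betw_def inv_into_image_cancel)
    then show ?thesis using d assms(1) by (auto simp: subgraph_def)
  qed
  ultimately show ?thesis
    using assms(1) by (auto simp: embedding_def subgraph_def bij_betw_def)
qed

text \<open>Used in contrapositive form: more than \<open>ex n H\<close> edges force an embedding of
  \<open>H\<close>.\<close>

lemma card_edges_le_ex:
  fixes G :: "nat ugraph"
  assumes "simple_graph G" "card (verts G) = n" "\<nexists>f. embedding H G f"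
  shows "card (edges G) \<le> ex n H"
  unfolding ex_def
proof (rule Max_ge)
  let ?S = "{card (edges G) |G :: nat ugraph. simple_graph G \<and> card (verts G) = n \<and>
    \<not> (\<exists>F. subgraph F G \<and> graph_iso F H)}"
  \<comment> \<open>Edge counts are at most \<open>n choose 2\<close>, so the maximum ranges over a
    finite set.\<close>
  have "?S \<subseteq> {..n choose 2}"
  proof
    fix k assume "k \<in> ?S"
    then obtain G :: "nat ugraph" where G: "k = card (edges G)" "simple_graph G" "card (verts G) = n"
      by auto
    then have "k \<le> card ([verts G]\<^bsup>2\<^esup>)"
      unfolding simple_graph_def by (metis card_mono finite_imp_finite_nsets)
    then show "k \<in> {..n choose 2}"
      using G by (simp add: card_nsets)
  qed
  then show "finite ?S"
    by (rule finite_subset) simp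
  show "card (edges G) \<in> ?S"
    using assms graph_iso_subgraph_embedding by blast
qed

lemma adjacency_path_invariant:
  assumes "connected_graph H" "u \<in> verts H" "v \<in> verts H"
    and "\<And>x y. {x, y} \<in> edges H \<Longrightarrow> f x = f y"
  shows "f u = f v"
proof -
  have "(u, v) \<in> {(x, y). {x, y} \<in> edges H}\<^sup>*"
    using assms(1-3) by (auto simp: connected_graph_def reachable_def)
  then show ?thesis
    by (induction rule: rtrancl_induct) (use assms(4) in auto)
qed

text \<open>The first step of a path to some other vertex is such an edge.\<close>

lemma connected_vertex_in_edge:
  assumes "connected_graph H" "card (verts H) \<ge> 2" "v \<in> verts H"
  shows "\<exists>e\<in>edges H. v \<in> e"
proof -
  have "verts H \<noteq> {v}"
    using assms(2) by auto
  then obtain u where "u \<in> verts H" "u \<noteq> v"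
    using assms(3) by blast
  then have "(v, u) \<in> {(x, y). {x, y} \<in> edges H}\<^sup>*"
    using assms by (auto simp: connected_graph_def reachable_def)
  then obtain w where "{v, w} \<in> edges H"
    using \<open>u \<noteq> v\<close> by (auto elim: converse_rtranclE)
  then show ?thesis by blast
qed

text \<open>A perfect matching contains no connected graph on three or more vertices.\<close>

lemma half_le_ex:
  assumes "connected_graph H" "card (verts H) \<ge> 3"
  shows "n div 2 \<le> ex n H"
proof -
  \<comment> \<open>The matching joins \<open>2 * i\<close> to \<open>2 * i + 1\<close>, so the two
    ends of an edge have the same quotient by 2.\<close>
  let ?m = "\<lambda>i::nat. {2 * i, 2 * i + 1}"
  define G where "G = Graph {..<n} (?m ` {..<n div 2})"
  have "inj_on ?m {..<n div 2}"
    by (auto simp: inj_on_def doubleton_eq_iff)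
  then have card: "card (edges G) = n div 2"
    by (simp add: G_def card_image)
  have simple: "simple_graph G"
    by (auto simp: simple_graph_def G_def)
  have "\<not> embedding H G f" for f
  proof
    assume f: "embedding H G f"
    obtain u where u: "u \<in> verts H"
      using assms(1) by (auto simp: connected_graph_def)
    have "f x div 2 = f y div 2" if "{x, y} \<in> edges H" for x y
    proof -
      have "f ` {x, y} \<in> edges G"
        using f that unfolding embedding_def by blast
      then show ?thesis
        by (auto simp: G_def doubleton_eq_iff)
    qed
    then have "f v div 2 = f u div 2" if "v \<in> verts H" for v
      using adjacency_path_invariant[OF assms(1) that u, of "\<lambda>x. f x div 2"] by blast
    \<comment> \<open>By connectivity the whole image of \<open>H\<close> lies in a single matching
      edge, which has too few vertices.\<close>
    then have sub: "f ` verts H \<subseteq> {2 * (f u div 2), 2 * (f u div 2) + 1}"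
      by (smt (verit) image_subset_iff insertCI mult_div_mod_eq not_mod_2_eq_1_eq_0 add.right_neutral)
    have "card (f ` verts H) \<le> card {2 * (f u div 2), 2 * (f u div 2) + 1}"
      by (rule card_mono) (use sub in auto)
    moreover have "card (f ` verts H) = card (verts H)"
      using f by (simp add: embedding_def card_image)
    ultimately show False
      using assms(2) by simp
  qed
  then have "card (edges G) \<le> ex n H"
    using simple by (intro card_edges_le_ex) (auto simp: G_def)
  then show ?thesis
    using card by simp
qed

text \<open>Deleting all edges that meet \<open>W\<close> leaves more than \<open>ex\<close> edges,
  hence a copy of \<open>H\<close>. Every vertex of \<open>H\<close> lies on an edge, so the copy
  misses \<open>W\<close>.\<close>

lemma embedding_avoiding:
  fixes G :: "nat ugraph"
  assumes "simple_graph G" "connected_graph H" "card (verts H) \<ge> 2" "finite W"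
    and "card (edges G) > ex (card (verts G)) H + card W * card (verts G)"
  shows "\<exists>f. embedding H G f \<and> f ` verts H \<inter> W = {}"
proof -
  \<comment> \<open>The vertices of \<open>W\<close> stay, as isolated vertices; the order, and with
    it the Turan bound, is unchanged.\<close>
  define G' where "G' = Graph (verts G) {e \<in> edges G. e \<inter> W = {}}"
  have simple: "simple_graph G'"
    using assms(1) by (auto simp: simple_graph_def G'_def)
  \<comment> \<open>A lost edge has an end in \<open>W\<close>, so there are at most
    \<open>card W * card (verts G)\<close> of them.\<close>
  have "edges G \<subseteq> edges G' \<union> (\<lambda>(w, v). {w, v}) ` (W \<times> verts G)"
  proof
    fix e assume e: "e \<in> edges G"
    then have "e \<in> [verts G]\<^bsup>2\<^esup>"
      using assms(1) by (auto simp: simple_graph_def)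
    then obtain x y where xy: "e = {x, y}" "x \<in> verts G" "y \<in> verts G"
      by (rule nsets2_E)
    then consider "e \<inter> W = {}" | "x \<in> W" | "y \<in> W"
      by auto
    then show "e \<in> edges G' \<union> (\<lambda>(w, v). {w, v}) ` (W \<times> verts G)"
      using e xy by cases (auto simp: G'_def image_iff insert_commute)
  qed
  moreover have fin: "finite (edges G')" "finite (verts G)"
    using simple simple_graph_finite_edges assms(1) by (auto simp: simple_graph_def)
  ultimately have "card (edges G) \<le> card (edges G' \<union> (\<lambda>(w, v). {w, v}) ` (W \<times> verts G))"
    using assms(4) by (intro card_mono) auto
  also have "\<dots> \<le> card (edges G') + card ((\<lambda>(w, v). {w, v}) ` (W \<times> verts G))"
    by (rule card_Un_le)
  also have "\<dots> \<le> card (edges G') + card W * card (verts G)"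
    using assms(4) fin by (metis add_le_cancel_left card_cartesian_product card_image_le finite_SigmaI)
  finally have "ex (card (verts G)) H < card (edges G')"
    using assms(5) by linarith
  then obtain f where f: "embedding H G' f"
    using card_edges_le_ex[OF simple, of "card (verts G)" H] by (auto simp: G'_def)
  have "f v \<notin> W" if v: "v \<in> verts H" for v
  proof -
    obtain e where "e \<in> edges H" "v \<in> e"
      using connected_vertex_in_edge assms v by metis
    then have "f v \<in> f ` e" "f ` e \<inter> W = {}"
      using f by (auto simp: embedding_def G'_def)
    then show ?thesis by blast
  qed
  then show ?thesis
    using f by (auto simp: embedding_def G'_def)
qed

text \<open>Greedy choice: the next copy avoids the set \<open>W\<close> of all vertices used so
  far, of which there are at most \<open>card (verts H)\<close> per earlier copy.\<close>

lemma disjoint_embeddings: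
  fixes G :: "nat ugraph"
  assumes "simple_graph G" "connected_graph H" "card (verts H) \<ge> 2"
    and "card (edges G) > ex (card (verts G)) H + M * card (verts H) * card (verts G)"
  shows "\<exists>f. (\<forall>i<M. embedding H G (f i)) \<and>
    (\<forall>i j. i < j \<and> j < M \<longrightarrow> f i ` verts H \<inter> f j ` verts H = {})"
  using assms(4)
proof (induction M)
  case 0
  then show ?case by simp
next
  case (Suc M)
  have "M * card (verts H) * card (verts G) \<le> Suc M * card (verts H) * card (verts G)"
    by (intro mult_le_mono1) simp
  then obtain f where f: "\<And>i. i < M \<Longrightarrow> embedding H G (f i)"
    "\<And>i j. i < j \<Longrightarrow> j < M \<Longrightarrow> f i ` verts H \<inter> f j ` verts H = {}"
    using Suc.IH Suc.prems by (meson add_le_cancel_left le_less_trans)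
  \<comment> \<open>Infinite sets have \<open>card\<close> 0, so the lower bound on the order gives
    finiteness.\<close>
  have fin: "finite (verts H)"
    using assms(3) by (metis card.infinite not_numeral_le_zero)
  define W where "W = (\<Union>i<M. f i ` verts H)"
  have "card W \<le> (\<Sum>i<M. card (f i ` verts H))"
    unfolding W_def by (rule card_UN_le) simp
  also have "\<dots> \<le> (\<Sum>i<M. card (verts H))"
    by (intro sum_mono card_image_le fin)
  finally have "card W * card (verts G) \<le> M * card (verts H) * card (verts G)"
    by simp
  then have "card (edges G) > ex (card (verts G)) H + card W * card (verts G)"
    using Suc.prems \<open>M * card (verts H) * card (verts G) \<le> _\<close> by linarith
  moreover have "finite W"
    using fin by (simp add: W_def)
  ultimately obtain g where g: "embedding H G g" "g ` verts H \<inter> W = {}"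
    using embedding_avoiding assms by blast
  have "\<forall>i<Suc M. embedding H G ((f(M := g)) i)"
    using f g by (auto simp: less_Suc_eq)
  moreover have "\<forall>i j. i < j \<and> j < Suc M \<longrightarrow>
      (f(M := g)) i ` verts H \<inter> (f(M := g)) j ` verts H = {}"
    using f(2) g(2) by (auto simp: less_Suc_eq W_def) blast+
  ultimately show ?case by blast
qed

section \<open>Copies of graphs in colour classes\<close>

text \<open>Turns around the direction in \<open>graph_iso\<close>: copies are built by maps from
  the pattern \<open>H\<close>, and the inverse is the required isomorphism.\<close>

lemma graph_isoI:
  assumes "bij_betw f (verts H) (verts G)" "edges G = (\<lambda>e. f ` e) ` edges H"
    and "\<And>e. e \<in> edges H \<Longrightarrow> e \<subseteq> verts H"
  shows "graph_iso G H"
proof -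
  let ?g = "inv_into (verts H) f"
  have "?g ` f ` e = e" if "e \<in> edges H" for e
    using assms(1) assms(3)[OF that] by (simp add: bij_betw_def inv_into_image_cancel)
  then have "edges H = (\<lambda>e. ?g ` e) ` edges G"
    by (simp add: assms(2) image_image)
  moreover have "bij_betw ?g (verts G) (verts H)"
    by (rule bij_betw_inv_into[OF assms(1)])
  ultimately show ?thesis
    by (auto simp: graph_iso_def)
qed

section \<open>Symmetry between the two colours\<close>

lemma two_edge_coloring_commute: "two_edge_coloring n R B \<longleftrightarrow> two_edge_coloring n B R"
  by (auto simp: two_edge_coloring_def)

lemma has_induced_mono_copy_commute: "has_induced_mono_copy n R B F \<longleftrightarrow> has_induced_mono_copy n B R F"
  by (auto simp: has_induced_mono_copy_def)

lemma has_mono_weakly_induced_copies_commute: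
  "has_mono_weakly_induced_copies R B r H \<longleftrightarrow> has_mono_weakly_induced_copies B R r H"
  by (auto simp: has_mono_weakly_induced_copies_def)

lemma two_edge_coloring_simple:
  assumes "two_edge_coloring n R B"
  shows "simple_graph R" "verts R = {..<n}"
  using assms by (auto simp: two_edge_coloring_def simple_graph_def complete_graph_def)

lemma two_edge_coloring_iff:
  assumes "two_edge_coloring n R B" "x < n" "y < n" "x \<noteq> y"
  shows "{x, y} \<in> edges B \<longleftrightarrow> {x, y} \<notin> edges R"
proof -
  have "{x, y} \<in> [{..<n}]\<^bsup>2\<^esup>"
    using assms by simp
  then show ?thesis
    using assms(1) by (auto simp: two_edge_coloring_def complete_graph_def)
qed

text \<open>The image of \<open>f\<close> serves as \<open>U\<close>. The last assumption is an
  equality of edge sets, which is what makes the copy induced; blue copies follow by swapping the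
  colours.\<close>

lemma has_induced_mono_copyI:
  assumes "inj_on f (verts F)" "f ` verts F \<subseteq> {..<n}"
    and "\<And>e. e \<in> edges F \<Longrightarrow> e \<subseteq> verts F"
    and "{e \<in> edges R. e \<subseteq> f ` verts F} = (\<lambda>e. f ` e) ` edges F"
  shows "has_induced_mono_copy n R B F"
proof -
  have "graph_iso (induced R (f ` verts F)) F"
    using assms by (intro graph_isoI[of f]) (auto simp: induced_def bij_betw_def)
  moreover have "card (f ` verts F) = card (verts F)"
    by (rule card_image[OF assms(1)])
  ultimately show ?thesis
    using assms(2) by (auto simp: has_induced_mono_copy_def complete_graph_def)
qed

section \<open>Induced complete bipartite and complete split graphs\<close>

lemma case_sum_image_Plus: "case_sum f g ` (A <+> B) = f ` A \<union> g ` B"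
  by (simp add: Plus_def image_Un image_image)

lemma inj_on_case_sum:
  assumes "inj_on f A" "inj_on g B" "f ` A \<inter> g ` B = {}"
  shows "inj_on (case_sum f g) (A <+> B)"
proof -
  have neq: "f a \<noteq> g b" if "a \<in> A" "b \<in> B" for a b
    using assms(3) that by blast
  show ?thesis
  proof (rule inj_onI)
    fix x y assume "x \<in> A <+> B" "y \<in> A <+> B" and eq: "case_sum f g x = case_sum f g y"
    then show "x = y"
      using neq inj_onD[OF assms(1)] inj_onD[OF assms(2)]
      by (elim PlusE) (simp_all, metis)
  qed
qed

lemma image_Collect_pairs:
  "(\<lambda>e. h ` e) ` {{u i, v j} | i j. P i j} = {{h (u i), h (v j)} | i j. P i j}"
proof (intro equalityI subsetI)
  fix e assume "e \<in> {{h (u i), h (v j)} | i j. P i j}"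
  then obtain i j where "P i j" "e = h ` {u i, v j}"
    by auto
  then show "e \<in> (\<lambda>e. h ` e) ` {{u i, v j} | i j. P i j}"
    by blast
qed blast

lemma has_induced_complete_bipartite:
  assumes R: "simple_graph R"
    and inj: "inj_on f {..<s}" "inj_on g {..<t}" "f ` {..<s} \<inter> g ` {..<t} = {}"
    and sub: "f ` {..<s} \<subseteq> {..<n}" "g ` {..<t} \<subseteq> {..<n}"
    and indep: "indep (f ` {..<s}) (edges R)" "indep (g ` {..<t}) (edges R)"
    and cross: "\<And>i j. i < s \<Longrightarrow> j < t \<Longrightarrow> {f i, g j} \<in> edges R"
  shows "has_induced_mono_copy n R B (complete_bipartite s t)"
proof (rule has_induced_mono_copyI[of "case_sum f g"])
  let ?K = "complete_bipartite s t" and ?h = "case_sum f g"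
  show "inj_on ?h (verts ?K)"
    using inj by (simp add: complete_bipartite_def inj_on_case_sum)
  have img: "?h ` verts ?K = f ` {..<s} \<union> g ` {..<t}"
    by (simp add: complete_bipartite_def case_sum_image_Plus)
  show "?h ` verts ?K \<subseteq> {..<n}"
    using sub by (simp add: img)
  show "e \<subseteq> verts ?K" if "e \<in> edges ?K" for e
    using that by (auto simp: complete_bipartite_def)
  have edges: "(\<lambda>e. ?h ` e) ` edges ?K = {{f i, g j} | i j. i < s \<and> j < t}"
    by (simp add: complete_bipartite_def image_Collect_pairs)
  show "{e \<in> edges R. e \<subseteq> ?h ` verts ?K} = (\<lambda>e. ?h ` e) ` edges ?K"
  proof (intro equalityI subsetI)
    fix e assume e: "e \<in> {e \<in> edges R. e \<subseteq> ?h ` verts ?K}"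
    then have "e \<in> [verts R]\<^bsup>2\<^esup>"
      using R by (auto simp: simple_graph_def)
    then obtain x y where xy: "e = {x, y}" "x \<noteq> y"
      by (rule nsets2_E)
    with e have "x \<in> f ` {..<s} \<union> g ` {..<t}" "y \<in> f ` {..<s} \<union> g ` {..<t}" "{x, y} \<in> edges R"
      unfolding img by simp_all
    \<comment> \<open>Independence of both sides leaves only edges that cross.\<close>
    then consider "x \<in> f ` {..<s}" "y \<in> g ` {..<t}" | "y \<in> f ` {..<s}" "x \<in> g ` {..<t}"
      using indep xy(2) unfolding indep_def by blast
    then show "e \<in> (\<lambda>e. ?h ` e) ` edges ?K"
      unfolding edges xy by cases (use insert_commute in blast)+
  next
    fix e assume "e \<in> (\<lambda>e. ?h ` e) ` edges ?K"
    then obtain i j where "e = {f i, g j}" "i < s" "j < t"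
      unfolding edges by blast
    then show "e \<in> {e \<in> edges R. e \<subseteq> ?h ` verts ?K}"
      using cross by (simp add: img)
  qed
qed

lemma has_induced_complete_split:
  assumes R: "simple_graph R"
    and inj: "inj_on f {..<s}" "inj_on g {..<t}" "f ` {..<s} \<inter> g ` {..<t} = {}"
    and sub: "f ` {..<s} \<subseteq> {..<n}" "g ` {..<t} \<subseteq> {..<n}"
    and clique: "clique (f ` {..<s}) (edges R)" and indep: "indep (g ` {..<t}) (edges R)"
    and cross: "\<And>i j. i < s \<Longrightarrow> j < t \<Longrightarrow> {f i, g j} \<in> edges R"
  shows "has_induced_mono_copy n R B (complete_split s t)"
proof (rule has_induced_mono_copyI[of "case_sum f g"])
  let ?K = "complete_split s t" and ?h = "case_sum f g"
  show "inj_on ?h (verts ?K)"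
    using inj by (simp add: complete_split_def inj_on_case_sum)
  have img: "?h ` verts ?K = f ` {..<s} \<union> g ` {..<t}"
    by (simp add: complete_split_def case_sum_image_Plus)
  show "?h ` verts ?K \<subseteq> {..<n}"
    using sub by (simp add: img)
  show "e \<subseteq> verts ?K" if "e \<in> edges ?K" for e
    using that by (auto simp: complete_split_def)
  have edges: "(\<lambda>e. ?h ` e) ` edges ?K =
      {{f i, f j} | i j. i < s \<and> j < s \<and> i \<noteq> j} \<union> {{f i, g j} | i j. i < s \<and> j < t}"
    by (simp add: complete_split_def image_Un image_Collect_pairs)
  show "{e \<in> edges R. e \<subseteq> ?h ` verts ?K} = (\<lambda>e. ?h ` e) ` edges ?K"
  proof (intro equalityI subsetI)
    fix e assume e: "e \<in> {e \<in> edges R. e \<subseteq> ?h ` verts ?K}"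
    then have "e \<in> [verts R]\<^bsup>2\<^esup>"
      using R by (auto simp: simple_graph_def)
    then obtain x y where xy: "e = {x, y}" "x \<noteq> y"
      by (rule nsets2_E)
    with e have "x \<in> f ` {..<s} \<union> g ` {..<t}" "y \<in> f ` {..<s} \<union> g ` {..<t}" "{x, y} \<in> edges R"
      unfolding img by simp_all
    \<comment> \<open>Only the \<open>g\<close> side is independent, so an edge may also lie inside
      the \<open>f\<close> side.\<close>
    then consider "x \<in> f ` {..<s}" "y \<in> f ` {..<s}" | "x \<in> f ` {..<s}" "y \<in> g ` {..<t}"
      | "y \<in> f ` {..<s}" "x \<in> g ` {..<t}"
      using indep xy(2) unfolding indep_def by blast
    then show "e \<in> (\<lambda>e. ?h ` e) ` edges ?K"
      unfolding edges xy(1) by cases (use xy(2) insert_commute in blast)+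
  next
    fix e assume "e \<in> (\<lambda>e. ?h ` e) ` edges ?K"
    then consider i j where "e = {f i, f j}" "i < s" "j < s" "i \<noteq> j"
      | i j where "e = {f i, g j}" "i < s" "j < t"
      unfolding edges by blast
    then show "e \<in> {e \<in> edges R. e \<subseteq> ?h ` verts ?K}"
    proof cases
      case 1
      then have "f i \<noteq> f j"
        using inj(1) by (auto simp: inj_on_def)
      then show ?thesis
        using 1 clique by (auto simp: clique_def img)
    qed (use cross in \<open>auto simp: img\<close>)
  qed
qed

section \<open>Components and weakly induced copies\<close>

lemma equiv_reachable: "equiv (verts G) (reachable G)"
proof (rule equivI)
  have "sym {(x, y). {x, y} \<in> edges G}"
    by (auto simp: sym_def insert_commute)
  then have "sym ({(x, y). {x, y} \<in> edges G}\<^sup>*)"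
    by (rule sym_rtrancl)
  then show "sym (reachable G)"
    unfolding sym_def reachable_def by blast
  show "trans (reachable G)"
    unfolding trans_def reachable_def by (blast intro: rtrancl_trans)
  show "refl_on (verts G) (reachable G)"
    by (rule refl_onI) (simp add: reachable_def)
  show "reachable G \<subseteq> verts G \<times> verts G"
    unfolding reachable_def by blast
qed

text \<open>The union \<open>F\<close> of the copies works: an edge of \<open>G\<close> between
  vertices of \<open>F\<close> must stay inside one copy, and a copy of the connected graph
  \<open>H\<close> lies in one component of \<open>F\<close>.\<close>

lemma weakly_induced_copies:
  fixes G :: "'b ugraph"
  assumes "simple_graph H" "connected_graph H" "simple_graph G"
    and emb: "\<And>i. i < r \<Longrightarrow> embedding H G (g i)"
    and disj: "\<And>i j. i < r \<Longrightarrow> j < r \<Longrightarrow> i \<noteq> j \<Longrightarrow> g i ` verts H \<inter> g j ` verts H = {}"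
    and no_edge: "\<And>i j a b. i < r \<Longrightarrow> j < r \<Longrightarrow> i \<noteq> j \<Longrightarrow> a \<in> verts H \<Longrightarrow> b \<in> verts H \<Longrightarrow>
      {g i a, g j b} \<notin> edges G"
  shows "\<exists>F. graph_iso F (disjoint_copies r H) \<and> weakly_induced F G"
proof -
  let ?D = "disjoint_copies r H" and ?h = "\<lambda>(i, a). g i a"
  define F where "F = Graph (?h ` verts ?D) ((\<lambda>e. ?h ` e) ` edges ?D)"
  have vF: "verts F = {g i a | i a. i < r \<and> a \<in> verts H}"
    by (auto simp: F_def disjoint_copies_def image_iff)
  have "edges F = {?h ` Pair i ` e | i e. i < r \<and> e \<in> edges H}"
    unfolding F_def disjoint_copies_def ugraph.sel by blast
  then have eF: "edges F = {g i ` e | i e. i < r \<and> e \<in> edges H}"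
    by (simp add: image_image)
  have inj: "inj_on ?h (verts ?D)"
  proof (rule inj_onI, clarify)
    fix i a j b assume "(i, a) \<in> verts ?D" "(j, b) \<in> verts ?D" and eq: "g i a = g j b"
    then have *: "i < r" "a \<in> verts H" "j < r" "b \<in> verts H"
      by (auto simp: disjoint_copies_def)
    then have "i = j"
      using disj[of i j] eq by blast
    moreover have "inj_on (g i) (verts H)"
      using emb * by (simp add: embedding_def)
    ultimately show "i = j \<and> a = b"
      using * eq by (auto simp: inj_on_def)
  qed
  have iso: "graph_iso F ?D"
  proof (rule graph_isoI[of ?h])
    show "bij_betw ?h (verts ?D) (verts F)"
      using inj by (simp add: F_def bij_betw_def)
    show "e \<subseteq> verts ?D" if "e \<in> edges ?D" for e
      using that edge_subset_verts[OF assms(1)] by (fastforce simp: disjoint_copies_def)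
  qed (simp add: F_def)
  have sub: "verts F \<subseteq> verts G" "edges F \<subseteq> edges G"
    using emb unfolding vF eF embedding_def by blast+
  have "edges F \<subseteq> [verts F]\<^bsup>2\<^esup>"
  proof
    fix e assume e: "e \<in> edges F"
    then have "e \<in> [verts G]\<^bsup>2\<^esup>"
      using sub(2) assms(3) by (auto simp: simple_graph_def)
    moreover have "e \<subseteq> verts F"
      using e edge_subset_verts[OF assms(1)] unfolding eF vF by fastforce
    ultimately show "e \<in> [verts F]\<^bsup>2\<^esup>"
      by (auto simp: nsets_def)
  qed
  moreover have "finite (verts F)"
    using sub(1) assms(3) finite_subset by (auto simp: simple_graph_def)
  ultimately have "subgraph F G"
    using sub by (auto simp: subgraph_def simple_graph_def)
  moreover have "X = Y"
    if "X \<in> components F" "Y \<in> components F" "x \<in> X" "y \<in> Y" "{x, y} \<in> edges G" for X Y x y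
  proof -
    have XY: "X \<in> verts F // reachable F" "Y \<in> verts F // reachable F"
      using that by (auto simp: components_def)
    then have "x \<in> verts F" "y \<in> verts F"
      using that(3,4) in_quotient_imp_subset[OF equiv_reachable] by blast+
    then obtain i a j b where ij: "x = g i a" "i < r" "a \<in> verts H" "y = g j b" "j < r" "b \<in> verts H"
      unfolding vF by blast
    then have "i = j"
      using no_edge[of i j a b] that(5) by blast
    \<comment> \<open>A path of \<open>H\<close> from \<open>a\<close> to \<open>b\<close> is
      carried by \<open>g i\<close> to a path of \<open>F\<close> from \<open>x\<close> to
      \<open>y\<close>.\<close>
    have "(a, b) \<in> {(x, y). {x, y} \<in> edges H}\<^sup>*"
      using assms(2) ij by (auto simp: connected_graph_def reachable_def)
    then have "(g i a, g i b) \<in> {(x, y). {x, y} \<in> edges F}\<^sup>*"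
    proof (induction rule: rtrancl_induct)
      case (step c d)
      then have "g i ` {c, d} \<in> edges F"
        unfolding eF using ij by blast
      then show ?case
        using step.IH by (simp add: rtrancl.rtrancl_into_rtrancl)
    qed simp
    then have "(x, y) \<in> reachable F"
      using ij \<open>i = j\<close> \<open>x \<in> verts F\<close> \<open>y \<in> verts F\<close> by (simp add: reachable_def)
    then show ?thesis
      using quotient_eq_iff[OF equiv_reachable XY that(3,4)] by simp
  qed
  ultimately have "weakly_induced F G"
    unfolding weakly_induced_def by blast
  with iso show ?thesis by blast
qed

section \<open>Monochromatic cliques\<close>

text \<open>\<open>M\<close> is fixed before \<open>n\<close> and the colouring. Ramsey is applied
  to the copies, with one colouring for each pair \<open>(a, b)\<close> of vertices of
  \<open>H\<close>; the resulting pattern \<open>q\<close> decides between a clique, a bipartite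
  graph and the excluded weakly induced copies.\<close>

lemma clique_or_induced_bipartite:
  fixes H :: "'a ugraph"
  assumes H: "simple_graph H" "connected_graph H"
  shows "\<exists>M::nat. \<forall>n R B f. two_edge_coloring n R B \<and> (\<forall>i<M. embedding H R (f i)) \<and>
    (\<forall>i j. i < j \<and> j < M \<longrightarrow> f i ` verts H \<inter> f j ` verts H = {}) \<and>
    \<not> has_mono_weakly_induced_copies R B r H \<longrightarrow>
    (\<exists>K\<subseteq>{..<n}. card K = m \<and> clique K (edges R)) \<or>
    has_induced_mono_copy n R B (complete_bipartite s t)"
proof -
  \<comment> \<open>The three outcomes use \<open>r\<close>, \<open>m\<close> and
    \<open>s + t\<close> copies respectively; the sum is long enough for each.\<close>
  let ?P = "verts H \<times> verts H" and ?N = "r + m + s + t"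
  have fin: "finite ?P"
    using H by (auto simp: simple_graph_def)
  obtain M where M: "\<forall>c::'a \<times> 'a \<Rightarrow> nat \<Rightarrow> nat \<Rightarrow> bool. \<exists>e. strict_mono_on {..<?N} e \<and>
      e ` {..<?N} \<subseteq> {..<M} \<and> (\<forall>p\<in>?P. homogeneous ?N (\<lambda>i j. c p (e i) (e j)))"
    using ramsey_increasing_simultaneous[OF fin, of ?N] by (rule exE)
  have step: "(\<exists>K\<subseteq>{..<n}. card K = m \<and> clique K (edges R)) \<or>
    has_induced_mono_copy n R B (complete_bipartite s t)"
    if col: "two_edge_coloring n R B" and emb': "\<forall>i<M. embedding H R (f i)"
      and disj': "\<forall>i j. i < j \<and> j < M \<longrightarrow> f i ` verts H \<inter> f j ` verts H = {}"
      and no_copies: "\<not> has_mono_weakly_induced_copies R B r H" for n R B f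
  proof -
    note emb = emb'[rule_format] and disj = disj'[rule_format, OF conjI]
    note R = two_edge_coloring_simple[OF col]
    obtain e where e: "strict_mono_on {..<?N} e" "e ` {..<?N} \<subseteq> {..<M}"
      and hom: "\<forall>p\<in>?P. homogeneous ?N (\<lambda>i j. {f (e i) (fst p), f (e j) (snd p)} \<in> edges R)"
      using M[THEN spec, of "\<lambda>p i j. {f i (fst p), f j (snd p)} \<in> edges R"]
      by (elim exE conjE) (rule that)
    have "\<exists>q. \<forall>i j. i < j \<and> j < ?N \<longrightarrow> ({f (e i) a, f (e j) b} \<in> edges R) = q"
      if "a \<in> verts H" "b \<in> verts H" for a b
      using hom[THEN bspec, of "(a, b)"] that by (simp add: homogeneous_def)
    then have "\<forall>a\<in>verts H. \<forall>b\<in>verts H. \<exists>q. \<forall>i j. i < j \<and> j < ?N \<longrightarrow>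
        ({f (e i) a, f (e j) b} \<in> edges R) = q"
      by (intro ballI)
    then obtain q' where q': "\<forall>a\<in>verts H. \<forall>b\<in>verts H. \<forall>i j. i < j \<and> j < ?N \<longrightarrow>
        ({f (e i) a, f (e j) b} \<in> edges R) = q' a b"
      unfolding bchoice_iff by (elim exE)
    define q where "q = (\<lambda>(a, b). q' a b)"
    have q: "{f (e i) a, f (e j) b} \<in> edges R \<longleftrightarrow> q (a, b)"
      if "a \<in> verts H" "b \<in> verts H" "i < j" "j < ?N" for a b i j
      using q'[rule_format, of a b i j] that by (simp add: q_def)
    define g where "g i = f (e i)" for i
    have gemb: "embedding H R (g i)" if "i < ?N" for i
      using emb e(2) that by (auto simp: g_def)
    have lt: "g i a < n" if "i < ?N" "a \<in> verts H" for i a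
      using gemb[OF that(1)] that(2) R(2) by (auto simp: embedding_def)
    have gdisj: "g i ` verts H \<inter> g j ` verts H = {}" if "i < j" "j < ?N" for i j
      unfolding g_def using that e by (intro disj) (auto simp: strict_mono_on_def)
    have neq: "g i a \<noteq> g j b" if "i \<noteq> j" "i < ?N" "j < ?N" "a \<in> verts H" "b \<in> verts H" for i j a b
      using that gdisj[of i j] gdisj[of j i] by (cases "i < j") fastforce+
    have eqD: "i = j" if "g i a = g j a" "i < ?N" "j < ?N" "a \<in> verts H" for i j a
      using neq[of i j a a] that by blast
    \<comment> \<open>For equal vertices of \<open>H\<close> the order of the two copies is
      irrelevant, as edges are unordered.\<close>
    have same: "{g i a, g j a} \<in> edges R \<longleftrightarrow> q (a, a)"
      if "i \<noteq> j" "i < ?N" "j < ?N" "a \<in> verts H" for i j a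
      using that q[of a a i j] q[of a a j i] unfolding g_def
      by (cases "i < j") (auto simp: insert_commute)
    show ?thesis
    proof (cases "\<exists>a\<in>verts H. q (a, a)")
      case True
      then obtain a where a: "a \<in> verts H" "q (a, a)" by blast
      let ?K = "(\<lambda>i. g i a) ` {..<m}"
      have "inj_on (\<lambda>i. g i a) {..<m}"
        using a by (auto intro!: inj_onI dest: eqD)
      then have "card ?K = m"
        by (simp add: card_image)
      moreover have "?K \<subseteq> {..<n}"
        using lt a by auto
      moreover have "clique ?K (edges R)"
        unfolding clique_def
      proof (intro ballI impI)
        fix x y assume "x \<in> ?K" "y \<in> ?K" "x \<noteq> y"
        then obtain i j where "x = g i a" "y = g j a" "i < m" "j < m" "i \<noteq> j"
          by auto
        then show "{x, y} \<in> edges R"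
          using same[of i j a] a by simp
      qed
      ultimately show ?thesis by blast
    next
      case no_clique: False
      have indep: "indep ((\<lambda>i. g (k i) a) ` I) (edges R)"
        if "a \<in> verts H" "\<And>i. i \<in> I \<Longrightarrow> k i < ?N" for a k and I :: "nat set"
        unfolding indep_def
      proof (intro ballI impI)
        fix x y assume "x \<in> (\<lambda>i. g (k i) a) ` I" "y \<in> (\<lambda>i. g (k i) a) ` I" "x \<noteq> y"
        then obtain i j where ij: "x = g (k i) a" "y = g (k j) a" "i \<in> I" "j \<in> I"
          by (elim imageE)
        with \<open>x \<noteq> y\<close> have "k i \<noteq> k j"
          by metis
        then have "{x, y} \<in> edges R \<longleftrightarrow> q (a, a)"
          unfolding ij(1,2) using ij(3,4) that by (intro same)
        then show "{x, y} \<notin> edges R"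
          using that(1) no_clique by blast
      qed
      show ?thesis
      proof (cases "\<exists>a\<in>verts H. \<exists>b\<in>verts H. q (a, b)")
        case True
        then obtain a b where ab: "a \<in> verts H" "b \<in> verts H" "q (a, b)" by blast
        have "has_induced_mono_copy n R B (complete_bipartite s t)"
        \<comment> \<open>One side takes the \<open>a\<close>-vertices of the first \<open>s\<close>
          copies, the other the \<open>b\<close>-vertices of the next \<open>t\<close>. The shift by
          \<open>s\<close> puts the former copies first, so cross pairs are governed by
          \<open>q (a, b)\<close> and never by \<open>q (b, a)\<close>.\<close>
        proof (rule has_induced_complete_bipartite[OF R(1), of "\<lambda>i. g i a" s "\<lambda>j. g (s + j) b"])
          show "inj_on (\<lambda>i. g i a) {..<s}" "inj_on (\<lambda>j. g (s + j) b) {..<t}"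
            using ab by (auto intro!: inj_onI dest: eqD)
          have "g i a \<noteq> g (s + j) b" if "i < s" "j < t" for i j
            using neq[of i "s + j" a b] that ab by simp
          then show "(\<lambda>i. g i a) ` {..<s} \<inter> (\<lambda>j. g (s + j) b) ` {..<t} = {}"
            by blast
          show "(\<lambda>i. g i a) ` {..<s} \<subseteq> {..<n}" "(\<lambda>j. g (s + j) b) ` {..<t} \<subseteq> {..<n}"
            using lt ab by auto
          show "indep ((\<lambda>i. g i a) ` {..<s}) (edges R)"
            by (rule indep[OF ab(1), of _ "\<lambda>i. i"]) simp
          show "indep ((\<lambda>j. g (s + j) b) ` {..<t}) (edges R)"
            by (rule indep[OF ab(2), of _ "\<lambda>j. s + j"]) simp
          show "{g i a, g (s + j) b} \<in> edges R" if "i < s" "j < t" for i j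
            using q[of a b i "s + j"] ab that by (simp add: g_def)
        qed
        then show ?thesis ..
      next
        case False
        \<comment> \<open>If \<open>j < i\<close>, the relevant entry is \<open>q (b, a)\<close>,
          which is false as well.\<close>
        have no_edge: "{g i a, g j b} \<notin> edges R"
          if "i < r" "j < r" "i \<noteq> j" "a \<in> verts H" "b \<in> verts H" for i j a b
          using that q[of a b i j] q[of b a j i] False unfolding g_def
          by (cases "i < j") (auto simp: insert_commute)
        have "\<exists>F. graph_iso F (disjoint_copies r H) \<and> weakly_induced F R"
        proof (rule weakly_induced_copies[OF H R(1), of r g])
          show "g i ` verts H \<inter> g j ` verts H = {}" if "i < r" "j < r" "i \<noteq> j" for i j
            using gdisj[of i j] gdisj[of j i] that by (cases "i < j") auto
        qed (use gemb no_edge in auto)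
        then show ?thesis
          using no_copies by (auto simp: has_mono_weakly_induced_copies_def)
      qed
    qed
  qed
  show ?thesis
    by (intro exI[of _ M] allI impI) (elim conjE, rule step, assumption+)
qed

text \<open>After making the cliques disjoint, Ramsey makes the edges between suitable parts of them
  monochromatic. If these are red, the red clique is the clique of the split graph in
  \<open>R\<close>; if blue, the blue clique plays that part in \<open>B\<close>.\<close>

lemma cliques_induced_split:
  "\<exists>m. \<forall>n R B K L. two_edge_coloring n R B \<and> K \<subseteq> {..<n} \<and> L \<subseteq> {..<n} \<and> card K = m \<and> card L = m \<and>
    clique K (edges R) \<and> clique L (edges B) \<longrightarrow> has_induced_mono_copy n R B (complete_split t t)"
proof -
  obtain M :: nat where M: "\<forall>c. \<exists>e. strict_mono_on {..<t + t} e \<and>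
      e ` {..<t + t} \<subseteq> {..<M} \<and> homogeneous (t + t) (\<lambda>i j. c (e i) (e j))"
    using ramsey_increasing[of "t + t"] by (rule exE)
  have "has_induced_mono_copy n R B (complete_split t t)"
    \<comment> \<open>The extra vertex in \<open>Suc M\<close> pays for the possible common vertex
      of \<open>K\<close> and \<open>L\<close>.\<close>
    if col: "two_edge_coloring n R B" and KL: "K \<subseteq> {..<n}" "L \<subseteq> {..<n}" "card K = Suc M" "card L = Suc M"
      and clique: "clique K (edges R)" "clique L (edges B)" for n R B K L
  proof -
    have fin: "finite K" "finite L"
      using KL finite_subset by blast+
    \<comment> \<open>Two common vertices would span an edge of both colours.\<close>
    have "x = y" if "x \<in> K \<inter> L" "y \<in> K \<inter> L" for x y
    proof (rule ccontr)
      assume "x \<noteq> y"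
      then have "{x, y} \<in> edges R \<inter> edges B"
        using that clique by (auto simp: clique_def)
      then show False
        using col by (auto simp: two_edge_coloring_def)
    qed
    then have "card (K \<inter> L) \<le> 1"
      using fin by (simp add: card_le_Suc0_iff_eq)
    then have "M \<le> card (L - K)"
      using KL(4) fin card_Int_Diff[of L K] by (simp add: Int_commute)
    then obtain b where b: "inj_on b {..<M}" "b ` {..<M} \<subseteq> L - K"
      using fin card_le_inj[of "{..<M}" "L - K"] by auto
    obtain a where a: "inj_on a {..<M}" "a ` {..<M} \<subseteq> K"
      using fin KL(3) card_le_inj[of "{..<M}" K] by auto
    obtain e where e: "strict_mono_on {..<t + t} e" "e ` {..<t + t} \<subseteq> {..<M}"
      and hom: "homogeneous (t + t) (\<lambda>i j. {a (e i), b (e j)} \<in> edges R)"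
      using M[THEN spec, of "\<lambda>i j. {a i, b j} \<in> edges R"] by (elim exE conjE) (rule that)
    obtain q where q: "\<forall>i j. i < j \<and> j < t + t \<longrightarrow> ({a (e i), b (e j)} \<in> edges R) = q"
      using hom unfolding homogeneous_def by (rule exE)
    \<comment> \<open>\<open>f\<close> uses the first \<open>t\<close> indices and \<open>g\<close>
      the last \<open>t\<close>, so every cross pair is increasing and has the homogeneous colour
      \<open>q\<close>.\<close>
    define f g where "f i = a (e i)" and "g j = b (e (t + j))" for i j
    have inj_e: "inj_on e {..<t + t}"
      using e(1) by (rule strict_mono_on_imp_inj_on)
    have eM: "e i < M" if "i < t + t" for i
      using e(2) that by auto
    have "f i = f j \<longleftrightarrow> i = j" "g i = g j \<longleftrightarrow> i = j" if "i < t" "j < t" for i j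
      unfolding f_def g_def using that eM
      by (simp_all add: inj_on_eq_iff[OF a(1)] inj_on_eq_iff[OF b(1)] inj_on_eq_iff[OF inj_e])
    then have injf: "inj_on f {..<t}" and injg: "inj_on g {..<t}"
      by (simp_all add: inj_on_def)
    have "a i \<in> K" "b i \<in> L - K" if "i < M" for i
      using a(2) b(2) that by blast+
    then have fK: "f ` {..<t} \<subseteq> K" and gL: "g ` {..<t} \<subseteq> L - K"
      unfolding f_def g_def using eM by (simp_all add: image_subset_iff)
    \<comment> \<open>A clique in one colour is independent in the other.\<close>
    have indep: "indep (g ` {..<t}) (edges R)" "indep (f ` {..<t}) (edges B)"
      using clique fK gL col
      unfolding indep_def clique_def two_edge_coloring_def by blast+
    have cl: "clique (f ` {..<t}) (edges R)" "clique (g ` {..<t}) (edges B)"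
      using clique fK gL by (auto intro: smaller_clique)
    have col': "two_edge_coloring n B R"
      using col by (simp add: two_edge_coloring_commute)
    have disj: "f ` {..<t} \<inter> g ` {..<t} = {}" and sub: "f ` {..<t} \<subseteq> {..<n}" "g ` {..<t} \<subseteq> {..<n}"
      using fK gL KL by blast+
    have cross: "{f i, g j} \<in> edges R \<longleftrightarrow> q" if "i < t" "j < t" for i j
      using q[rule_format, of i "t + j"] that by (simp add: f_def g_def)
    show ?thesis
    proof (cases q)
      case True
      with cross show ?thesis
        by (intro has_induced_complete_split[of R f t g t] two_edge_coloring_simple[OF col])
          (use injf injg disj sub cl indep in auto)
    next
      case False
      have "{g j, f i} \<in> edges B" if "j < t" "i < t" for i j
      proof -
        have "f i < n" "g j < n" "f i \<noteq> g j"
          using that disj sub by blast+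
        then show ?thesis
          using cross[OF that(2,1)] False two_edge_coloring_iff[OF col]
          by (metis insert_commute)
      qed
      then have "has_induced_mono_copy n B R (complete_split t t)"
        by (intro has_induced_complete_split[of B g t f t] two_edge_coloring_simple[OF col'])
          (use injf injg disj sub cl indep in auto)
      then show ?thesis
        by (simp add: has_induced_mono_copy_commute)
    qed
  qed
  then show ?thesis by blast
qed

section \<open>The constant, and the two colours combined\<close>

theorem theorem4p1:
  fixes r s t :: nat and H :: "'a ugraph"
  assumes "r \<ge> 2" and "s \<ge> 1" and "t \<ge> max 2 s"
    and "simple_graph H" and "connected_graph H" and "bipartite H" and "card (verts H) \<ge> 3"
  shows "\<exists>C::real. \<forall>\<^sub>F n in sequentially. \<forall>R B.
    two_edge_coloring n R B \<and>
    real (min (card (edges R)) (card (edges B))) \<ge> C * real (ex n H) \<and>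
    \<not> has_mono_weakly_induced_copies R B r H
    \<longrightarrow> (\<exists>F\<in>family s t. has_induced_mono_copy n R B F)"
proof -
  obtain m where m: "\<And>n R B K L. two_edge_coloring n R B \<Longrightarrow> K \<subseteq> {..<n} \<Longrightarrow> L \<subseteq> {..<n} \<Longrightarrow>
      card K = m \<Longrightarrow> card L = m \<Longrightarrow> clique K (edges R) \<Longrightarrow> clique L (edges B) \<Longrightarrow>
      has_induced_mono_copy n R B (complete_split t t)"
    using cliques_induced_split[of t] by blast
  obtain M :: nat where M: "\<forall>n R B f. two_edge_coloring n R B \<and> (\<forall>i<M. embedding H R (f i)) \<and>
      (\<forall>i j. i < j \<and> j < M \<longrightarrow> f i ` verts H \<inter> f j ` verts H = {}) \<and>
      \<not> has_mono_weakly_induced_copies R B r H \<longrightarrow>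
      (\<exists>K\<subseteq>{..<n}. card K = m \<and> clique K (edges R)) \<or>
      has_induced_mono_copy n R B (complete_bipartite s t)"
    using clique_or_induced_bipartite[OF assms(4,5), of r m s t] by (rule exE)
  \<comment> \<open>As \<open>n \<le> 3 * ex n H\<close>, the second summand pays for the vertices
    of \<open>M\<close> disjoint copies. Of the 2, one unit is the Turan threshold and the other
    makes the inequality strict.\<close>
  define C where "C = 2 + 3 * (M * card (verts H))"
  have "\<exists>F\<in>family s t. has_induced_mono_copy n R B F"
    if "n \<ge> 2" and col: "two_edge_coloring n R B"
      and many: "real (min (card (edges R)) (card (edges B))) \<ge> real C * real (ex n H)"
      and no_copies: "\<not> has_mono_weakly_induced_copies R B r H" for n R B
  proof -
    have half: "n div 2 \<le> ex n H"
      by (rule half_le_ex[OF assms(5,7)])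
    have "C * ex n H \<le> min (card (edges R)) (card (edges B))"
      using many by (metis of_nat_le_iff of_nat_mult)
    moreover have "ex n H + M * card (verts H) * n < C * ex n H"
    proof -
      \<comment> \<open>For \<open>n \<ge> 2\<close> one has \<open>n \<le> 3 * (n div 2)\<close>,
        with equality at 3; at \<open>n = 1\<close> this fails.\<close>
      have "n \<le> 3 * ex n H" "0 < ex n H"
        using half \<open>n \<ge> 2\<close> by linarith+
      then have "M * card (verts H) * n \<le> M * card (verts H) * (3 * ex n H)"
        by (intro mult_le_mono2)
      moreover have "C * ex n H = ex n H + ex n H + M * card (verts H) * (3 * ex n H)"
        by (simp add: C_def algebra_simps)
      ultimately show ?thesis
        using \<open>0 < ex n H\<close> by linarith
    qed
    ultimately have large: "ex n H + M * card (verts H) * n < card (edges R)"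
      "ex n H + M * card (verts H) * n < card (edges B)"
      by linarith+
    \<comment> \<open>Stated for arbitrary \<open>R'\<close> and \<open>B'\<close>, to be applied
      once with each colour in the leading role.\<close>
    have alt: "(\<exists>K\<subseteq>{..<n}. card K = m \<and> clique K (edges R')) \<or>
        has_induced_mono_copy n R' B' (complete_bipartite s t)"
      if col': "two_edge_coloring n R' B'" and "\<not> has_mono_weakly_induced_copies R' B' r H"
        and "ex n H + M * card (verts H) * n < card (edges R')" for R' B'
    proof -
      have "\<exists>f. (\<forall>i<M. embedding H R' (f i)) \<and>
          (\<forall>i j. i < j \<and> j < M \<longrightarrow> f i ` verts H \<inter> f j ` verts H = {})"
        by (rule disjoint_embeddings)
          (use two_edge_coloring_simple[OF col'] that(3) assms(5,7) in simp_all)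
      then obtain f where "(\<forall>i<M. embedding H R' (f i)) \<and>
          (\<forall>i j. i < j \<and> j < M \<longrightarrow> f i ` verts H \<inter> f j ` verts H = {})"
        by (rule exE)
      with col' that(2) show ?thesis
        by (intro M[THEN spec, THEN spec, THEN spec, THEN spec, THEN mp, of n R' B' f]) blast
    qed
    have "(\<exists>K\<subseteq>{..<n}. card K = m \<and> clique K (edges B)) \<or>
        has_induced_mono_copy n B R (complete_bipartite s t)"
      by (rule alt)
        (use col no_copies large(2) two_edge_coloring_commute has_mono_weakly_induced_copies_commute
          in blast)+
    moreover have "(\<exists>K\<subseteq>{..<n}. card K = m \<and> clique K (edges R)) \<or>
        has_induced_mono_copy n R B (complete_bipartite s t)"
      by (rule alt[OF col no_copies large(1)])
    \<comment> \<open>Without an induced \<open>K_{s,t}\<close> both applications give cliques of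
      size \<open>m\<close>, one red and one blue, and these produce the split graph.\<close>
    ultimately have "has_induced_mono_copy n R B (complete_bipartite s t) \<or>
        has_induced_mono_copy n R B (complete_split t t)"
      using m[OF col] has_induced_mono_copy_commute by blast
    then show ?thesis
      by (simp add: family_def)
  qed
  then have "\<forall>\<^sub>F n in sequentially. \<forall>R B.
    two_edge_coloring n R B \<and>
    real (min (card (edges R)) (card (edges B))) \<ge> real C * real (ex n H) \<and>
    \<not> has_mono_weakly_induced_copies R B r H
    \<longrightarrow> (\<exists>F\<in>family s t. has_induced_mono_copy n R B F)"
    by (intro eventually_sequentiallyI[of 2]) blast
  then show ?thesis by blast
qed

end
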